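(* Let $H$ be a Riemannian homogeneous space with killing fields $K^1,\dots,K^m$ obtained from a basis of the Lie algebra of a Lie group acting transitively on $H$ by isometries, let $\kappa>0$ be a $C^{(1,1)}$ kernel on $H$, and let $p_\theta(x)\propto\exp(\theta^\top\zeta(x)+\eta(x))$, $\theta\in\mathbb{R}^s$, with $\zeta=(\zeta_1,\dots,\zeta_s)^\top\in C^1(H,\mathbb{R}^s)$ and $\eta\in C^1(H,\mathbb{R})$. Let $n\ge 2$, let $x_1,\dots,x_n\in H$ and let $q^w:H\to[0,\infty)$ be a weight function. Let $Q_u,Q_v\in\mathbb{R}^{s\times s}$, $b_u,b_v\in\mathbb{R}^s$ and $U^w_n(\theta),V^w_n(\theta)$ be as defined in the context. Then $Q_u$ and $Q_v$ are symmetric, and $Q_v$ is positive semi-definite. If further $Q_u$ is positive semi-definite, then the sets of global minimizers of $U^w_n$ and $V^w_n$ over $\theta\in\mathbb{R}^s$ are $$\operatorname{argmin}U^w_n(\theta)=\{-Q_u^+b_u-(I-Q_u^+Q_u)x:x\in\mathbb{R}^s\},$$ $$\operatorname{argmin}V^w_n(\theta)=\{-Q_v^+b_v-(I-Q_v^+Q_v)x:x\in\mathbb{R}^s\},$$ where $A^+$ denotes the Moore–Penrose inverse of $A$. (The unweighted case is $q^w\equiv1$.)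
   Context: Kernels are real-valued, symmetric and positive semi-definite; $C^{(1,1)}$ means once continuously differentiable in each argument with continuous mixed derivative of order $(1,1)$. If a Lie group $G$ acts on $H$ by isometries, the killing field corresponding to $E\in T_eG$ is $K_x=\frac{d}{dt}|_{t=0}\mathfrak{e}(t).x$ for a curve $\mathfrak{e}$ in $G$ with $\mathfrak{e}(0)=e$, $\mathfrak{e}'(0)=E$. For a bivariate function, $K^l_x$ and $K^l_y$ denote $K^l$ acting on the first argument $x$ and the second argument $y$, respectively. For a density $p>0$ (known up to normalization), $$\kappa_p(x,y)=\kappa(x,y)\sum_{l=1}^m\left[K^l_x\log(p(x)\kappa(x,y))\cdot K^l_y\log(p(y)\kappa(x,y))+K^l_yK^l_x\log\kappa(x,y)\right].$$ The weighted empirical kernel Stein discrepancies are $$U^w_n(\theta)=\frac{1}{n(n-1)}\sum_{i\ne j}\kappa_{p_\theta}(x_i,x_j)q^w(x_i)q^w(x_j),\qquad V^w_n(\theta)=\frac1{n^2}\sum_{i,j}\kappa_{p_\theta}(x_i,x_j)q^w(x_i)q^w(x_j).$$ (In applications $q^w=dQ/d\Lambda$ is the Radon–Nikodym derivative of the distribution $Q$ to be approximated with respect to a sampling distribution $\Lambda$, and $x_i$ are samples from $\Lambda$.) Set $$Q(x,y)=\kappa(x,y)\sum_{l=1}^mK^l_x\zeta\cdot K^l_y\zeta^\top\in\mathbb{R}^{s\times s},\qquad b(x,y)=\kappa(x,y)\sum_{l=1}^mK^l_x\log(e^{\eta(x)}\kappa(x,y))\cdot K^l_y\zeta\in\mathbb{R}^s,$$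 where $K^l_x\zeta=(K^l\zeta_1(x),\dots,K^l\zeta_s(x))^\top$, and $$Q_u=\sum_{i\ne j}\frac{Q(x_i,x_j)}{n(n-1)}q^w(x_i)q^w(x_j),\quad b_u=\sum_{i\ne j}\frac{b(x_i,x_j)}{n(n-1)}q^w(x_i)q^w(x_j),$$ $$Q_v=\sum_{i,j}\frac{Q(x_i,x_j)}{n^2}q^w(x_i)q^w(x_j),\quad b_v=\sum_{i,j}\frac{b(x_i,x_j)}{n^2}q^w(x_i)q^w(x_j).$$ With these, $U^w_n(\theta)=\theta^\top Q_u\theta+2b_u^\top\theta+c_u$ and $V^w_n(\theta)=\theta^\top Q_v\theta+2b_v^\top\theta+c_v$ for constants $c_u,c_v$ independent of $\theta$.
   Formalization: The formula for argmin U is asserted only when U attains a global minimum, since for Q_u merely positive semi-definite U may be unbounded below and the claim false; manifolds are taken of dimension at least 1. *)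

theory Defs
  imports "HOL-Analysis.Analysis" "HOL-Algebra.Group_Action"
begin

section \<open>Functions of class \<open>C\<^sup>k\<close> on open subsets of a Euclidean space\<close>

primrec ck_on :: "nat \<Rightarrow> 'a::euclidean_space set \<Rightarrow> ('a \<Rightarrow> 'b::real_normed_vector) \<Rightarrow> bool" where
  "ck_on 0 S f \<longleftrightarrow> continuous_on S f"
| "ck_on (Suc k) S f \<longleftrightarrow>
     f differentiable_on S \<and> (\<forall>v. ck_on k S (\<lambda>x. frechet_derivative f (at x) v))"

definition smooth_on :: "'a::euclidean_space set \<Rightarrow> ('a \<Rightarrow> 'b::real_normed_vector) \<Rightarrow> bool" where
  "smooth_on S f \<longleftrightarrow> (\<forall>k. ck_on k S f)"


section \<open>Smooth manifolds\<close>

text \<open>The underlying topological space of a manifold is a type; the Hausdorff and second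
  countability axioms are type class constraints. A chart \<open>(U, \<phi>)\<close> is a homeomorphism \<open>\<phi>\<close> of the
  open set \<open>U\<close> onto an open subset of the model space; the values of \<open>\<phi>\<close> outside \<open>U\<close> are
  irrelevant.\<close>

type_synonym ('h, 'e) chart = "'h set \<times> ('h \<Rightarrow> 'e)"

definition inv_chart :: "('h, 'e) chart \<Rightarrow> 'e \<Rightarrow> 'h" where
  "inv_chart c = inv_into (fst c) (snd c)"

definition chart_image :: "('h, 'e) chart \<Rightarrow> 'e set" where
  "chart_image c = snd c ` fst c"

definition is_chart :: "('h::topological_space, 'e::euclidean_space) chart \<Rightarrow> bool" where
  "is_chart c \<longleftrightarrow> open (fst c) \<and> open (chart_image c) \<and>
     homeomorphism (fst c) (chart_image c) (snd c) (inv_chart c)"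

definition smooth_manifold ::
  "('h::{t2_space, second_countable_topology}, 'e::euclidean_space) chart set \<Rightarrow> bool" where
  "smooth_manifold A \<longleftrightarrow>
     (\<forall>c\<in>A. is_chart c) \<and> (\<Union>c\<in>A. fst c) = UNIV \<and>
     (\<forall>c\<in>A. \<forall>d\<in>A. smooth_on (snd c ` (fst c \<inter> fst d)) (snd d \<circ> inv_chart c))"

definition prod_atlas :: "('g, 'd) chart set \<Rightarrow> ('h, 'e) chart set \<Rightarrow> ('g \<times> 'h, 'd \<times> 'e) chart set" where
  "prod_atlas A B = {(fst c \<times> fst d, map_prod (snd c) (snd d)) | c d. c \<in> A \<and> d \<in> B}"

definition smooth_map ::
  "('g::topological_space, 'd::euclidean_space) chart set \<Rightarrow>
   ('h::topological_space, 'e::euclidean_space) chart set \<Rightarrow> ('g \<Rightarrow> 'h) \<Rightarrow> bool" where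
  "smooth_map A B f \<longleftrightarrow> continuous_on UNIV f \<and>
     (\<forall>c\<in>A. \<forall>d\<in>B. smooth_on (snd c ` (fst c \<inter> f -` fst d)) (snd d \<circ> f \<circ> inv_chart c))"

definition C1_fun ::
  "('h, 'e::euclidean_space) chart set \<Rightarrow> ('h \<Rightarrow> 'b::real_normed_vector) \<Rightarrow> bool" where
  "C1_fun A f \<longleftrightarrow> (\<forall>c\<in>A. ck_on 1 (chart_image c) (f \<circ> inv_chart c))"


section \<open>Tangent vectors\<close>

text \<open>A tangent vector at \<open>x\<close> is the family of its coordinate vectors in all the charts around \<open>x\<close>,
  related by the differentials of the coordinate changes. The components at the other charts are
  fixed to \<open>0\<close>, so that equality of tangent vectors is equality of functions and the vector
  space structure is the pointwise one.\<close>

type_synonym ('h, 'e) tangent = "('h, 'e) chart \<Rightarrow> 'e"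

definition charts_at :: "('h, 'e) chart set \<Rightarrow> 'h \<Rightarrow> ('h, 'e) chart set" where
  "charts_at A x = {c \<in> A. x \<in> fst c}"

definition chart_at :: "('h, 'e) chart set \<Rightarrow> 'h \<Rightarrow> ('h, 'e) chart" where
  "chart_at A x = (SOME c. c \<in> charts_at A x)"

definition tangent_space ::
  "('h, 'e::euclidean_space) chart set \<Rightarrow> 'h \<Rightarrow> ('h, 'e) tangent set" where
  "tangent_space A x = {X.
     (\<forall>c. c \<notin> charts_at A x \<longrightarrow> X c = 0) \<and>
     (\<forall>c\<in>charts_at A x. \<forall>d\<in>charts_at A x.
        X d = frechet_derivative (snd d \<circ> inv_chart c) (at (snd c x)) (X c))}"

definition coord_vector ::
  "('h, 'e::euclidean_space) chart set \<Rightarrow> ('h, 'e) chart \<Rightarrow> 'h \<Rightarrow> 'e \<Rightarrow> ('h, 'e) tangent" where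
  "coord_vector A c x u = (\<lambda>d. if d \<in> charts_at A x
     then frechet_derivative (snd d \<circ> inv_chart c) (at (snd c x)) u else 0)"

definition differential ::
  "('g, 'd::euclidean_space) chart set \<Rightarrow> ('h, 'e::euclidean_space) chart set \<Rightarrow>
   ('g \<Rightarrow> 'h) \<Rightarrow> 'g \<Rightarrow> ('g, 'd) tangent \<Rightarrow> ('h, 'e) tangent" where
  "differential A B f x X = (\<lambda>d. if d \<in> charts_at B (f x)
     then (let c = chart_at A x
           in frechet_derivative (snd d \<circ> f \<circ> inv_chart c) (at (snd c x)) (X c))
     else 0)"

definition has_velocity ::
  "('h::t2_space, 'e::euclidean_space) chart set \<Rightarrow> (real \<Rightarrow> 'h) \<Rightarrow> real \<Rightarrow> ('h, 'e) tangent \<Rightarrow> bool"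
  where
  "has_velocity A \<gamma> t X \<longleftrightarrow> isCont \<gamma> t \<and>
     (\<forall>c. c \<notin> charts_at A (\<gamma> t) \<longrightarrow> X c = 0) \<and>
     (\<forall>c\<in>charts_at A (\<gamma> t). ((snd c \<circ> \<gamma>) has_vector_derivative X c) (at t))"

definition tangent_basis ::
  "('h, 'e::euclidean_space) chart set \<Rightarrow> 'h \<Rightarrow> nat \<Rightarrow> (nat \<Rightarrow> ('h, 'e) tangent) \<Rightarrow> bool" where
  "tangent_basis A x m E \<longleftrightarrow>
     (\<forall>l\<in>{1..m}. E l \<in> tangent_space A x) \<and>
     (\<forall>X\<in>tangent_space A x.
        \<exists>!a. a \<in> {1..m} \<rightarrow>\<^sub>E (UNIV :: real set) \<and> X = (\<lambda>c. \<Sum>l=1..m. a l *\<^sub>R E l c))"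

text \<open>\<open>field_deriv A K f x\<close> is the derivative \<open>K f (x)\<close> of the function \<open>f\<close> in the direction of the
  tangent vector \<open>K x\<close>; it does not depend on the chart used.\<close>

definition field_deriv ::
  "('h, 'e::euclidean_space) chart set \<Rightarrow> ('h \<Rightarrow> ('h, 'e) tangent) \<Rightarrow> ('h \<Rightarrow> real) \<Rightarrow> 'h \<Rightarrow> real"
  where
  "field_deriv A K f x = (let c = chart_at A x
     in frechet_derivative (f \<circ> inv_chart c) (at (snd c x)) (K x c))"


section \<open>Riemannian homogeneous spaces and killing fields\<close>

definition riemannian_metric ::
  "('h, 'e::euclidean_space) chart set \<Rightarrow>
   ('h \<Rightarrow> ('h, 'e) tangent \<Rightarrow> ('h, 'e) tangent \<Rightarrow> real) \<Rightarrow> bool" where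
  "riemannian_metric A g \<longleftrightarrow>
     (\<forall>x. \<forall>X\<in>tangent_space A x. \<forall>Y\<in>tangent_space A x.
        g x X Y = g x Y X \<and> (X \<noteq> (\<lambda>c. 0) \<longrightarrow> g x X X > 0) \<and>
        (\<forall>Z\<in>tangent_space A x. \<forall>a b.
           g x (\<lambda>c. a *\<^sub>R X c + b *\<^sub>R Y c) Z = a * g x X Z + b * g x Y Z)) \<and>
     (\<forall>c\<in>A. \<forall>u v. smooth_on (chart_image c)
        (\<lambda>y. g (inv_chart c y) (coord_vector A c (inv_chart c y) u)
                               (coord_vector A c (inv_chart c y) v)))"

definition lie_group ::
  "('g::{t2_space, second_countable_topology}) monoid \<Rightarrow> ('g, 'd::euclidean_space) chart set \<Rightarrow> bool"
  where
  "lie_group G A \<longleftrightarrow> group G \<and> carrier G = UNIV \<and> smooth_manifold A \<and>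
     smooth_map (prod_atlas A A) A (\<lambda>(a, b). a \<otimes>\<^bsub>G\<^esub> b) \<and> smooth_map A A (\<lambda>a. inv\<^bsub>G\<^esub> a)"

text \<open>A Riemannian manifold \<open>H\<close> (atlas \<open>AH\<close>, metric \<open>g\<close>) together with a Lie group \<open>G\<close> (atlas \<open>AG\<close>)
  that acts on it smoothly, transitively and by isometries.\<close>

definition riemannian_homogeneous_space ::
  "('h::{t2_space, second_countable_topology}, 'e::euclidean_space) chart set \<Rightarrow>
   ('h \<Rightarrow> ('h, 'e) tangent \<Rightarrow> ('h, 'e) tangent \<Rightarrow> real) \<Rightarrow>
   ('g::{t2_space, second_countable_topology}) monoid \<Rightarrow> ('g, 'd::euclidean_space) chart set \<Rightarrow>
   ('g \<Rightarrow> 'h \<Rightarrow> 'h) \<Rightarrow> bool" where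
  "riemannian_homogeneous_space AH g G AG act \<longleftrightarrow>
     smooth_manifold AH \<and> riemannian_metric AH g \<and> lie_group G AG \<and>
     transitive_action G UNIV act \<and>
     smooth_map (prod_atlas AG AH) AH (\<lambda>(a, x). act a x) \<and>
     (\<forall>a x. \<forall>X\<in>tangent_space AH x. \<forall>Y\<in>tangent_space AH x.
        g (act a x) (differential AH AH (act a) x X) (differential AH AH (act a) x Y) = g x X Y)"

definition killing_field ::
  "('h::t2_space, 'e::euclidean_space) chart set \<Rightarrow> 'g::t2_space monoid \<Rightarrow>
   ('g, 'd::euclidean_space) chart set \<Rightarrow> ('g \<Rightarrow> 'h \<Rightarrow> 'h) \<Rightarrow>
   ('g, 'd) tangent \<Rightarrow> ('h \<Rightarrow> ('h, 'e) tangent) \<Rightarrow> bool" where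
  "killing_field AH G AG act E K \<longleftrightarrow>
     (\<exists>\<gamma>. \<gamma> 0 = \<one>\<^bsub>G\<^esub> \<and> has_velocity AG \<gamma> 0 E \<and>
          (\<forall>x. has_velocity AH (\<lambda>t. act (\<gamma> t) x) 0 (K x)))"


section \<open>Kernels\<close>

definition psd_kernel :: "('h \<Rightarrow> 'h \<Rightarrow> real) \<Rightarrow> bool" where
  "psd_kernel \<kappa> \<longleftrightarrow> (\<forall>x y. \<kappa> x y = \<kappa> y x) \<and>
     (\<forall>(n::nat) x a. 0 \<le> (\<Sum>i<n. \<Sum>j<n. a i * a j * \<kappa> (x i) (x j)))"

text \<open>All partial derivatives of order at most one in each argument, and the mixed one, exist
  and are jointly continuous. As kernels are symmetric and \<open>c\<close>, \<open>d\<close> range over all pairs of charts,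
  it is enough to require one of the two orders of differentiation.\<close>

definition C11_kernel ::
  "('h, 'e::euclidean_space) chart set \<Rightarrow> ('h \<Rightarrow> 'h \<Rightarrow> real) \<Rightarrow> bool" where
  "C11_kernel A \<kappa> \<longleftrightarrow> (\<forall>c\<in>A. \<forall>d\<in>A.
     let S = chart_image c; T = chart_image d;
         F = (\<lambda>a b. \<kappa> (inv_chart c a) (inv_chart d b));
         D1 = (\<lambda>u a b. frechet_derivative (\<lambda>a'. F a' b) (at a) u);
         D2 = (\<lambda>v a b. frechet_derivative (\<lambda>b'. F a b') (at b) v);
         D12 = (\<lambda>u v a b. frechet_derivative (\<lambda>b'. D1 u a b') (at b) v)
     in continuous_on (S \<times> T) (\<lambda>(a, b). F a b) \<and>
        (\<forall>b\<in>T. (\<lambda>a. F a b) differentiable_on S) \<and>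
        (\<forall>a\<in>S. (\<lambda>b. F a b) differentiable_on T) \<and>
        (\<forall>u. \<forall>a\<in>S. (\<lambda>b. D1 u a b) differentiable_on T) \<and>
        (\<forall>u. continuous_on (S \<times> T) (\<lambda>(a, b). D1 u a b)) \<and>
        (\<forall>v. continuous_on (S \<times> T) (\<lambda>(a, b). D2 v a b)) \<and>
        (\<forall>u v. continuous_on (S \<times> T) (\<lambda>(a, b). D12 u v a b)))"


section \<open>Kernel Stein discrepancies\<close>

definition stein_kernel ::
  "('h, 'e::euclidean_space) chart set \<Rightarrow> nat \<Rightarrow> (nat \<Rightarrow> 'h \<Rightarrow> ('h, 'e) tangent) \<Rightarrow>
   ('h \<Rightarrow> 'h \<Rightarrow> real) \<Rightarrow> ('h \<Rightarrow> real) \<Rightarrow> 'h \<Rightarrow> 'h \<Rightarrow> real" where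
  "stein_kernel A m K \<kappa> p x y = \<kappa> x y * (\<Sum>l=1..m.
     field_deriv A (K l) (\<lambda>x'. ln (p x' * \<kappa> x' y)) x *
     field_deriv A (K l) (\<lambda>y'. ln (p y' * \<kappa> x y')) y +
     field_deriv A (K l) (\<lambda>y'. field_deriv A (K l) (\<lambda>x'. ln (\<kappa> x' y')) x) y)"

text \<open>Weighted U- and V-statistics of a real, vector or matrix valued function \<open>h\<close> of two points.\<close>

definition U_stat ::
  "nat \<Rightarrow> (nat \<Rightarrow> 'h) \<Rightarrow> ('h \<Rightarrow> real) \<Rightarrow> ('h \<Rightarrow> 'h \<Rightarrow> 'b::real_vector) \<Rightarrow> 'b" where
  "U_stat n x w h = (1 / (real n * (real n - 1))) *\<^sub>R
     (\<Sum>i=1..n. \<Sum>j\<in>{1..n} - {i}. (w (x i) * w (x j)) *\<^sub>R h (x i) (x j))"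

definition V_stat ::
  "nat \<Rightarrow> (nat \<Rightarrow> 'h) \<Rightarrow> ('h \<Rightarrow> real) \<Rightarrow> ('h \<Rightarrow> 'h \<Rightarrow> 'b::real_vector) \<Rightarrow> 'b" where
  "V_stat n x w h = (1 / (real n)\<^sup>2) *\<^sub>R
     (\<Sum>i=1..n. \<Sum>j=1..n. (w (x i) * w (x j)) *\<^sub>R h (x i) (x j))"

definition field_deriv_vec ::
  "('h, 'e::euclidean_space) chart set \<Rightarrow> ('h \<Rightarrow> ('h, 'e) tangent) \<Rightarrow> ('h \<Rightarrow> real ^ 's) \<Rightarrow>
   'h \<Rightarrow> real ^ 's" where
  "field_deriv_vec A K \<zeta> x = (\<chi> i. field_deriv A K (\<lambda>x'. \<zeta> x' $ i) x)"

definition Q_fun ::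
  "('h, 'e::euclidean_space) chart set \<Rightarrow> nat \<Rightarrow> (nat \<Rightarrow> 'h \<Rightarrow> ('h, 'e) tangent) \<Rightarrow>
   ('h \<Rightarrow> 'h \<Rightarrow> real) \<Rightarrow> ('h \<Rightarrow> real ^ 's) \<Rightarrow> 'h \<Rightarrow> 'h \<Rightarrow> real ^ 's ^ 's" where
  "Q_fun A m K \<kappa> \<zeta> x y = \<kappa> x y *\<^sub>R (\<Sum>l=1..m.
     (\<chi> i j. field_deriv_vec A (K l) \<zeta> x $ i * field_deriv_vec A (K l) \<zeta> y $ j))"

definition b_fun ::
  "('h, 'e::euclidean_space) chart set \<Rightarrow> nat \<Rightarrow> (nat \<Rightarrow> 'h \<Rightarrow> ('h, 'e) tangent) \<Rightarrow>
   ('h \<Rightarrow> 'h \<Rightarrow> real) \<Rightarrow> ('h \<Rightarrow> real ^ 's) \<Rightarrow> ('h \<Rightarrow> real) \<Rightarrow> 'h \<Rightarrow> 'h \<Rightarrow> real ^ 's" where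
  "b_fun A m K \<kappa> \<zeta> \<eta> x y = \<kappa> x y *\<^sub>R (\<Sum>l=1..m.
     field_deriv A (K l) (\<lambda>x'. ln (exp (\<eta> x') * \<kappa> x' y)) x *\<^sub>R field_deriv_vec A (K l) \<zeta> y)"


section \<open>Matrices and minimizers\<close>

definition symmetric_matrix :: "real ^ 's ^ 's \<Rightarrow> bool" where
  "symmetric_matrix A \<longleftrightarrow> transpose A = A"

definition psd_matrix :: "real ^ 's ^ 's \<Rightarrow> bool" where
  "psd_matrix A \<longleftrightarrow> symmetric_matrix A \<and> (\<forall>v. 0 \<le> v \<bullet> (A *v v))"

text \<open>The Moore--Penrose inverse, characterised by the four Penrose equations.\<close>

definition pinv :: "real ^ 'n ^ 'm \<Rightarrow> real ^ 'm ^ 'n" where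
  "pinv A = (THE X. A ** X ** A = A \<and> X ** A ** X = X \<and>
     transpose (A ** X) = A ** X \<and> transpose (X ** A) = X ** A)"

text \<open>Empty if the minimum is not attained.\<close>

definition argmin :: "('a \<Rightarrow> real) \<Rightarrow> 'a set" where
  "argmin f = {t. \<forall>t'. f t \<le> f t'}"

end

theory Submission
  imports Defs
begin

text \<open>Since \<open>log p\<^sub>\<theta>\<close> is affine in \<open>\<theta>\<close>, the discrepancies are quadratic in \<open>\<theta>\<close>. A quadratic
  function with positive semi-definite matrix \<open>A\<close> and linear term \<open>2 b\<close> is minimal exactly where
  \<open>A \<theta> = - b\<close>, and the Moore--Penrose inverse describes all solutions as soon as there is one. For
  \<open>V\<close> there always is one, because \<open>b\<^sub>v\<close> is orthogonal to the null space of \<open>Q\<^sub>v\<close>.\<close>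

section \<open>The Moore--Penrose inverse\<close>

definition penrose_inverse :: "real ^ 'n ^ 'm \<Rightarrow> real ^ 'm ^ 'n \<Rightarrow> bool" where
  "penrose_inverse A X \<longleftrightarrow> A ** X ** A = A \<and> X ** A ** X = X \<and>
     transpose (A ** X) = A ** X \<and> transpose (X ** A) = X ** A"

text \<open>\<open>A ** X\<close> and \<open>A ** Y\<close> are the same orthogonal projection onto
  the range of \<open>A\<close>, and \<open>X ** A\<close>, \<open>Y ** A\<close> the same one onto
  the row space; \<open>X = X ** A ** X\<close> then recovers \<open>X\<close>.\<close>

lemma penrose_inverse_unique:
  assumes "penrose_inverse A X" and "penrose_inverse A Y"
  shows "X = Y"
proof -
  note X = assms(1)[unfolded penrose_inverse_def] and Y = assms(2)[unfolded penrose_inverse_def]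
  have "A ** X = A ** Y ** (A ** X)"
    using Y by (metis matrix_mul_assoc)
  also have "\<dots> = transpose (A ** X ** (A ** Y))"
    using X Y by (metis matrix_transpose_mul)
  also have "A ** X ** (A ** Y) = A ** Y"
    using X by (metis matrix_mul_assoc)
  finally have AX: "A ** X = A ** Y"
    using Y by metis
  have "X ** A = X ** A ** (Y ** A)"
    using Y by (metis matrix_mul_assoc)
  also have "\<dots> = transpose (Y ** A ** (X ** A))"
    using X Y by (metis matrix_transpose_mul)
  also have "Y ** A ** (X ** A) = Y ** A"
    using X by (metis matrix_mul_assoc)
  finally have XA: "X ** A = Y ** A"
    using Y by metis
  have "X = X ** (A ** X)"
    using X by (metis matrix_mul_assoc)
  also have "\<dots> = X ** A ** Y"
    by (simp add: AX matrix_mul_assoc)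
  also have "\<dots> = Y"
    using Y by (simp add: XA)
  finally show ?thesis .
qed

lemma symmetric_matrix_iff_inner:
  "symmetric_matrix A \<longleftrightarrow> (\<forall>u v. (A *v u) \<bullet> v = u \<bullet> (A *v v))"
proof
  assume "symmetric_matrix A"
  then show "\<forall>u v. (A *v u) \<bullet> v = u \<bullet> (A *v v)"
    by (metis dot_lmul_matrix symmetric_matrix_def transpose_matrix_vector)
next
  assume *: "\<forall>u v. (A *v u) \<bullet> v = u \<bullet> (A *v v)"
  have "transpose A *v v = A *v v" for v
  proof -
    have "u \<bullet> (transpose A *v v) = u \<bullet> (A *v v)" for u
      using * by (metis dot_lmul_matrix inner_commute transpose_matrix_vector)
    then show ?thesis
      by (metis vector_eq_ldot)
  qed
  then show "symmetric_matrix A"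
    unfolding symmetric_matrix_def by (simp add: matrix_eq)
qed

text \<open>The Moore--Penrose inverse maps \<open>y\<close> to the unique least squares solution \<open>z\<close> of \<open>A z = y\<close>
  that lies in the row space of \<open>A\<close>.\<close>

lemma penrose_inverse_exists:
  fixes A :: "real ^ 'n ^ 'm"
  shows "\<exists>X. penrose_inverse A X"
proof -
  let ?R = "range ((*v) A)" and ?S = "range ((*v) (transpose A))"
  have adj: "(transpose A *v u) \<bullet> v = u \<bullet> (A *v v)" for u v
    by (metis dot_lmul_matrix transpose_matrix_vector)
  have subR: "subspace ?R" and subS: "subspace ?S"
    by (rule linear_subspace_image[OF matrix_vector_mul_linear subspace_UNIV])+
  \<comment> \<open>\<open>z - z'\<close> lies both in the row space and in the null space of
    \<open>A\<close>, which are orthogonal.\<close>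
  have inj: "z = z'" if zz: "z \<in> ?S" "z' \<in> ?S" "A *v z = A *v z'" for z z'
  proof -
    obtain u where u: "z - z' = transpose A *v u"
      using subspace_diff[OF subS zz(1,2)] by auto
    have "(z - z') \<bullet> (z - z') = u \<bullet> (A *v (z - z'))"
      by (subst u) (rule adj)
    also have "\<dots> = 0"
      using zz(3) by (simp add: matrix_vector_mult_diff_distrib)
    finally show ?thesis by simp
  qed
  \<comment> \<open>The second conjunct is the normal equations: the residual is orthogonal to the
    range of \<open>A\<close>.\<close>
  define P where "P y z \<longleftrightarrow> z \<in> ?S \<and> (\<forall>w. (A *v z - y) \<bullet> (A *v w) = 0)" for y z
  have ex: "\<exists>z. P y z" for y
  proof -
    obtain p q where p: "p \<in> span ?R" "\<And>w. w \<in> span ?R \<Longrightarrow> orthogonal q w" "y = p + q"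
      by (rule orthogonal_subspace_decomp_exists) blast
    have spanR: "span ?R = ?R"
      using subR by (simp only: span_eq_iff)
    obtain z0 where z0: "p = A *v z0"
      using p(1) spanR by auto
    obtain z r where z: "z \<in> span ?S" "\<And>w. w \<in> span ?S \<Longrightarrow> orthogonal r w" "z0 = z + r"
      by (rule orthogonal_subspace_decomp_exists) blast
    have spanS: "span ?S = ?S"
      using subS by (simp only: span_eq_iff)
    \<comment> \<open>\<open>r\<close> is orthogonal to the row space vector
      \<open>transpose A *v (A *v r)\<close>, so passing from \<open>z0\<close> to its projection
      \<open>z\<close> does not change the image under \<open>A\<close>.\<close>
    have "(A *v r) \<bullet> (A *v r) = 0"
      using z(2)[OF span_base[OF rangeI], of "A *v r"] adj[of "A *v r" r]
      by (simp add: orthogonal_def inner_commute)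
    then have "A *v z = p"
      by (simp add: z0 z(3) matrix_vector_right_distrib)
    then have "(A *v z - y) \<bullet> (A *v w) = 0" for w
      using p(2)[of "A *v w"] p(3) spanR by (simp add: orthogonal_def)
    then show ?thesis
      using z(1) spanS P_def by blast
  qed
  have uniq: "z = z'" if "P y z" "P y z'" for y z z'
  proof (rule inj)
    let ?d = "A *v z - A *v z'"
    have "?d \<bullet> ?d = (A *v z - y) \<bullet> (A *v (z - z')) - (A *v z' - y) \<bullet> (A *v (z - z'))"
      by (simp add: matrix_vector_mult_diff_distrib inner_diff_left)
    also have "\<dots> = 0"
      using that by (simp add: P_def)
    finally show "A *v z = A *v z'" by simp
  qed (use that in \<open>auto simp: P_def\<close>)
  define f where "f y = (SOME z. P y z)" for y
  have f: "P y (f y)" for y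
    unfolding f_def using ex by (rule someI_ex)
  have fS: "f y \<in> ?S" and f_orth: "(A *v f y) \<bullet> (A *v w) = y \<bullet> (A *v w)" for y w
    using f[of y] by (auto simp: P_def inner_diff_left)
  \<comment> \<open>\<open>P\<close> is preserved by sums and multiples, so uniqueness makes the
    chosen solution linear.\<close>
  have "linear f"
  proof (rule linearI)
    show "f (y + z) = f y + f z" for y z
    proof (rule uniq[OF f])
      show "P (y + z) (f y + f z)"
        unfolding P_def using subspace_add[OF subS fS fS] f_orth
        by (simp add: matrix_vector_right_distrib inner_add_left inner_diff_left)
    qed
    show "f (a *\<^sub>R y) = a *\<^sub>R f y" for a y
    proof (rule uniq[OF f])
      show "P (a *\<^sub>R y) (a *\<^sub>R f y)"
        unfolding P_def using subspace_scale[OF subS fS] f_orth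
        by (simp add: matrix_vector_mult_scaleR inner_diff_left)
    qed
  qed
  define X where "X = matrix f"
  have X: "X *v y = f y" for y
    using \<open>linear f\<close> by (simp add: X_def matrix_works)
  \<comment> \<open>For data in the range of \<open>A\<close> the residual lies in that range and is
    orthogonal to it, hence zero.\<close>
  have AfA: "A *v f (A *v z) = A *v z" for z
  proof -
    let ?d = "A *v f (A *v z) - A *v z"
    have "?d \<bullet> ?d = ?d \<bullet> (A *v (f (A *v z) - z))"
      by (simp add: matrix_vector_mult_diff_distrib)
    also have "\<dots> = 0"
      by (simp add: inner_diff_left f_orth)
    finally show ?thesis by simp
  qed
  have fAf: "f (A *v f y) = f y" for y
    by (rule inj[OF fS fS AfA])
  \<comment> \<open>\<open>f (A *v u)\<close> is the projection of \<open>u\<close> onto the row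
    space, which contains \<open>f y\<close>; this gives the symmetry of
    \<open>X ** A\<close>.\<close>
  have fA_orth: "f (A *v u) \<bullet> f y = u \<bullet> f y" for u y
  proof -
    obtain w where "f y = transpose A *v w"
      using fS by blast
    then show ?thesis
      using AfA adj by (metis inner_commute)
  qed
  have "A ** X ** A = A" "X ** A ** X = X"
    by (simp_all add: matrix_eq matrix_vector_mul_assoc[symmetric] X AfA fAf)
  moreover have "symmetric_matrix (A ** X)"
    unfolding symmetric_matrix_iff_inner
    by (simp add: matrix_vector_mul_assoc[symmetric] X) (metis f_orth inner_commute)
  moreover have "symmetric_matrix (X ** A)"
    unfolding symmetric_matrix_iff_inner
    by (simp add: matrix_vector_mul_assoc[symmetric] X) (metis fA_orth inner_commute)
  ultimately show ?thesis
    unfolding penrose_inverse_def symmetric_matrix_def by blast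
qed

lemma penrose_inverse_pinv: "penrose_inverse A (pinv A)"
proof -
  have "\<exists>!X. penrose_inverse A X"
    using penrose_inverse_exists penrose_inverse_unique by blast
  moreover have "pinv A = (THE X. penrose_inverse A X)"
    by (simp only: pinv_def penrose_inverse_def)
  ultimately show ?thesis
    by (simp only: theI')
qed

text \<open>Solvability gives \<open>A *v (pinv A *v b) = b\<close>, and
  \<open>mat 1 - pinv A ** A\<close> has the null space of \<open>A\<close> as its range. A given
  solution \<open>\<theta>\<close> is obtained with \<open>z = - \<theta>\<close>.\<close>

lemma solutions_eq_pinv:
  assumes "A *v \<theta>0 = b"
  shows "{\<theta>. A *v \<theta> = b} = {pinv A *v b - (mat 1 - pinv A ** A) *v z | z. z \<in> UNIV}"
proof -
  have AXA: "A ** pinv A ** A = A"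
    using penrose_inverse_pinv[of A] by (simp add: penrose_inverse_def)
  have AX: "A *v (pinv A *v (A *v z)) = A *v z" for z
    by (metis AXA matrix_vector_mul_assoc)
  show ?thesis
  proof (intro Set.set_eqI iffI)
    fix \<theta> assume "\<theta> \<in> {\<theta>. A *v \<theta> = b}"
    then have "\<theta> = pinv A *v b - (mat 1 - pinv A ** A) *v (- \<theta>)"
      by (auto simp: matrix_vector_mult_diff_rdistrib matrix_vector_mul_assoc[symmetric]
          linear_neg[OF matrix_vector_mul_linear])
    then show "\<theta> \<in> {pinv A *v b - (mat 1 - pinv A ** A) *v z | z. z \<in> UNIV}"
      by blast
  next
    fix \<theta> assume "\<theta> \<in> {pinv A *v b - (mat 1 - pinv A ** A) *v z | z. z \<in> UNIV}"
    then show "\<theta> \<in> {\<theta>. A *v \<theta> = b}"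
      using assms AX
      by (auto simp: matrix_vector_mult_diff_rdistrib matrix_vector_mul_assoc[symmetric]
          matrix_vector_mult_diff_distrib)
  qed
qed

section \<open>Minimizers of quadratic functions\<close>

text \<open>The polynomial vanishes at \<open>t = 0\<close>, so that is a minimum and the derivative
  \<open>2 * b\<close> there is zero.\<close>

lemma linear_term_zero:
  fixes a b :: real
  assumes "\<And>t. 0 \<le> t\<^sup>2 * a + 2 * t * b"
  shows "b = 0"
proof (cases "a = 0")
  case True
  then show ?thesis
    using assms[of "- b"] by (simp add: power2_eq_square[symmetric])
next
  case False
  have a: "a > 0"
    \<comment> \<open>The two instances add up to \<open>0 \<le> 2 * a\<close>.\<close>
    using assms[of 1] assms[of "-1"] False by simp
  \<comment> \<open>The vertex of the parabola is at \<open>t = - (b / a)\<close>.\<close>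
  have "0 \<le> (b / a)\<^sup>2 * a + 2 * (- (b / a)) * b"
    using assms[of "- (b / a)"] by simp
  also have "\<dots> = - (b\<^sup>2 / a)"
    using a by (simp add: power2_eq_square)
  finally show ?thesis
    using a by (simp add: divide_le_0_iff)
qed

lemma argmin_quadratic:
  fixes A :: "real ^ 's ^ 's"
  assumes "psd_matrix A"
  shows "argmin (\<lambda>\<theta>. \<theta> \<bullet> (A *v \<theta>) + 2 * (b \<bullet> \<theta>) + c) = {\<theta>. A *v \<theta> = - b}"
proof -
  let ?f = "\<lambda>\<theta>. \<theta> \<bullet> (A *v \<theta>) + 2 * (b \<bullet> \<theta>) + c"
  have sym: "(A *v u) \<bullet> v = u \<bullet> (A *v v)" for u v
    using assms symmetric_matrix_iff_inner unfolding psd_matrix_def by blast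
  have expand: "?f (\<theta> + t *\<^sub>R v) - ?f \<theta> = t\<^sup>2 * (v \<bullet> (A *v v)) + 2 * t * ((A *v \<theta> + b) \<bullet> v)" for \<theta> t v
    by (simp add: matrix_vector_right_distrib matrix_vector_mult_scaleR inner_add_left inner_add_right
        sym power2_eq_square inner_commute[of v "A *v \<theta>"] algebra_simps)
  show ?thesis
  proof (intro Set.set_eqI iffI)
    fix \<theta> assume "\<theta> \<in> argmin ?f"
    then have "?f \<theta> \<le> ?f (\<theta> + t *\<^sub>R v)" for t v
      by (auto simp: argmin_def)
    then have "(A *v \<theta> + b) \<bullet> v = 0" for v
      by (intro linear_term_zero[of "v \<bullet> (A *v v)"]) (metis expand diff_ge_0_iff_ge)
    \<comment> \<open>The test direction is half the gradient at \<open>\<theta>\<close>, which is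
      thus orthogonal to itself.\<close>
    from this[of "A *v \<theta> + b"] show "\<theta> \<in> {\<theta>. A *v \<theta> = - b}"
      by (simp add: eq_neg_iff_add_eq_0)
  next
    fix \<theta> assume "\<theta> \<in> {\<theta>. A *v \<theta> = - b}"
    then have "?f (\<theta> + v) - ?f \<theta> = v \<bullet> (A *v v)" for v
      using expand[of \<theta> 1 v] by simp
    then have "?f \<theta> \<le> ?f (\<theta> + v)" for v
      using assms unfolding psd_matrix_def by (metis diff_ge_0_iff_ge)
    from this[of "t - \<theta>" for t] show "\<theta> \<in> argmin ?f"
      by (auto simp: argmin_def)
  qed
qed

text \<open>The right-hand set is never empty, so solvability has to be supplied: by a solution (for
  \<open>V\<close>) or by an attained minimum (for \<open>U\<close>).\<close>

lemma argmin_quadratic_pinv: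
  fixes A :: "real ^ 's ^ 's"
  assumes "psd_matrix A" and f: "\<And>\<theta>. f \<theta> = \<theta> \<bullet> (A *v \<theta>) + 2 * (b \<bullet> \<theta>) + c"
    and "A *v \<theta>0 = - b \<or> argmin f \<noteq> {}"
  shows "argmin f = {- (pinv A *v b) - (mat 1 - pinv A ** A) *v z | z. z \<in> UNIV}"
proof -
  have argmin: "argmin f = {\<theta>. A *v \<theta> = - b}"
    using argmin_quadratic[OF assms(1)] f by presburger
  then obtain \<theta>1 where "A *v \<theta>1 = - b"
    using assms(3) by auto
  from solutions_eq_pinv[OF this] argmin show ?thesis
    by (simp add: linear_neg[OF matrix_vector_mul_linear])
qed

text \<open>The range of a symmetric matrix is the orthogonal complement of its null space: the part
  \<open>z\<close> of \<open>b\<close> orthogonal to the range is a null vector, hence orthogonal to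
  \<open>b\<close> and so to itself.\<close>

lemma symmetric_solvable:
  fixes A :: "real ^ 's ^ 's"
  assumes "symmetric_matrix A" and "\<And>v. A *v v = 0 \<Longrightarrow> b \<bullet> v = 0"
  shows "\<exists>\<theta>. A *v \<theta> = b"
proof -
  let ?R = "range ((*v) A)"
  have "subspace ?R"
    by (rule linear_subspace_image[OF matrix_vector_mul_linear subspace_UNIV])
  then have span: "span ?R = ?R"
    by (simp only: span_eq_iff)
  obtain y z where yz: "y \<in> span ?R" "\<And>w. w \<in> span ?R \<Longrightarrow> orthogonal z w" "b = y + z"
    by (rule orthogonal_subspace_decomp_exists) blast
  have "(A *v z) \<bullet> (A *v z) = z \<bullet> (A *v (A *v z))"
    using assms(1) symmetric_matrix_iff_inner by blast
  also have "\<dots> = 0"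
    using yz(2)[of "A *v (A *v z)"] span by (simp add: orthogonal_def)
  finally have "b \<bullet> z = 0"
    by (intro assms(2)) simp
  moreover have "y \<bullet> z = 0"
    using yz(1,2) by (simp add: orthogonal_def inner_commute)
  ultimately have "z = 0"
    using yz(3) by (simp add: inner_add_left)
  then show ?thesis
    using yz(1,3) span by auto
qed

section \<open>Derivatives along vector fields\<close>

text \<open>Asked only in the chart where \<open>field_deriv\<close> is evaluated, so that
  coordinate changes never enter.\<close>

definition chart_differentiable ::
  "('h, 'e::euclidean_space) chart set \<Rightarrow> ('h \<Rightarrow> 'b::real_normed_vector) \<Rightarrow> 'h \<Rightarrow> bool" where
  "chart_differentiable A f x \<longleftrightarrow>
     (f \<circ> inv_chart (chart_at A x)) differentiable (at (snd (chart_at A x) x))"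

lemma chart_at_in:
  assumes "smooth_manifold A"
  shows "chart_at A x \<in> A" and "x \<in> fst (chart_at A x)"
proof -
  have "x \<in> (\<Union>c\<in>A. fst c)"
    using assms by (simp add: smooth_manifold_def)
  then have "\<exists>c. c \<in> charts_at A x"
    by (auto simp: charts_at_def)
  then have "chart_at A x \<in> charts_at A x"
    unfolding chart_at_def by (rule someI_ex)
  then show "chart_at A x \<in> A" and "x \<in> fst (chart_at A x)"
    by (auto simp: charts_at_def)
qed

lemma chart_at_point:
  assumes "smooth_manifold A"
  shows "open (chart_image (chart_at A x))"
    and "snd (chart_at A x) x \<in> chart_image (chart_at A x)"
    and "inv_chart (chart_at A x) (snd (chart_at A x) x) = x"
proof -
  have c: "is_chart (chart_at A x)"
    using assms chart_at_in(1)[OF assms] by (simp add: smooth_manifold_def)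
  then show "open (chart_image (chart_at A x))"
    by (simp add: is_chart_def)
  show "snd (chart_at A x) x \<in> chart_image (chart_at A x)"
    using chart_at_in(2)[OF assms] by (simp add: chart_image_def)
  show "inv_chart (chart_at A x) (snd (chart_at A x) x) = x"
    using c chart_at_in(2)[OF assms] by (auto simp: is_chart_def homeomorphism_def)
qed

lemma C1_fun_chart_differentiable:
  assumes "smooth_manifold A" and "C1_fun A f"
  shows "chart_differentiable A f x"
proof -
  have "(f \<circ> inv_chart (chart_at A x)) differentiable_on chart_image (chart_at A x)"
    using assms chart_at_in(1)[OF assms(1)] by (auto simp: C1_fun_def)
  then show ?thesis
    unfolding chart_differentiable_def
    using chart_at_point(1,2)[OF assms(1), of x] differentiable_on_eq_differentiable_at by blast
qed

lemma C11_kernel_chart_differentiable: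
  assumes "smooth_manifold A" and "C11_kernel A \<kappa>"
  shows "chart_differentiable A (\<lambda>x'. \<kappa> x' y) x"
proof -
  let ?c = "chart_at A x" and ?d = "chart_at A y"
  have "\<forall>b\<in>chart_image ?d. (\<lambda>a. \<kappa> (inv_chart ?c a) (inv_chart ?d b)) differentiable_on chart_image ?c"
    using assms(2) chart_at_in(1)[OF assms(1)] unfolding C11_kernel_def Let_def by blast
  then have "(\<lambda>a. \<kappa> (inv_chart ?c a) y) differentiable_on chart_image ?c"
    using chart_at_point(2,3)[OF assms(1), of y] by metis
  then show ?thesis
    unfolding chart_differentiable_def o_def
    using chart_at_point(1,2)[OF assms(1), of x] differentiable_on_eq_differentiable_at by blast
qed

lemma chart_has_derivative:
  assumes "chart_differentiable A f x"
  shows "((\<lambda>a. f (inv_chart (chart_at A x) a)) has_derivative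
    frechet_derivative (f \<circ> inv_chart (chart_at A x)) (at (snd (chart_at A x) x)))
    (at (snd (chart_at A x) x))"
  using assms unfolding chart_differentiable_def frechet_derivative_works by (simp add: o_def)

text \<open>Reduces each calculus rule for \<open>field_deriv\<close> to the Frechet rule in one
  chart.\<close>

lemma field_derivI:
  assumes "((\<lambda>a. f (inv_chart (chart_at A x) a)) has_derivative f') (at (snd (chart_at A x) x))"
  shows "chart_differentiable A f x" and "field_deriv A K f x = f' (K x (chart_at A x))"
  using assms frechet_derivative_at[OF assms]
  by (auto simp: chart_differentiable_def field_deriv_def o_def differentiable_def Let_def)

lemma field_deriv_const: "field_deriv A K (\<lambda>_. c) x = 0"
  by (subst field_derivI(2)[where f'="\<lambda>_. 0"]) auto

lemma
  assumes "chart_differentiable A f x" and "chart_differentiable A g x"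
  shows field_deriv_add:
      "field_deriv A K (\<lambda>y. f y + g y) x = field_deriv A K f x + field_deriv A K g x"
    and chart_differentiable_add: "chart_differentiable A (\<lambda>y. f y + g y) x"
proof -
  note d = has_derivative_add[OF assms[THEN chart_has_derivative]]
  show "field_deriv A K (\<lambda>y. f y + g y) x = field_deriv A K f x + field_deriv A K g x"
    by (subst field_derivI(2)[OF d]) (simp add: field_deriv_def Let_def)
  show "chart_differentiable A (\<lambda>y. f y + g y) x"
    by (rule field_derivI(1)[OF d])
qed

text \<open>Serves to drop the logarithm of the normalizing constant.\<close>

lemma field_deriv_diff_const:
  assumes "chart_differentiable A f x"
  shows "field_deriv A K (\<lambda>y. f y - c) x = field_deriv A K f x"
proof -
  have d: "((\<lambda>a. f (inv_chart (chart_at A x) a) - c) has_derivative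
    frechet_derivative (f \<circ> inv_chart (chart_at A x)) (at (snd (chart_at A x) x)))
    (at (snd (chart_at A x) x))"
    using has_derivative_diff[OF chart_has_derivative[OF assms] has_derivative_const] by simp
  show ?thesis
    by (subst field_derivI(2)[OF d]) (simp add: field_deriv_def Let_def)
qed

lemma field_deriv_sum_mult:
  assumes "\<And>i. i \<in> I \<Longrightarrow> chart_differentiable A (f i) x"
  shows "field_deriv A K (\<lambda>y. \<Sum>i\<in>I. a i * f i y) x = (\<Sum>i\<in>I. a i * field_deriv A K (f i) x)"
proof -
  have d: "((\<lambda>b. \<Sum>i\<in>I. a i * f i (inv_chart (chart_at A x) b)) has_derivative
    (\<lambda>v. \<Sum>i\<in>I. a i * frechet_derivative (f i \<circ> inv_chart (chart_at A x)) (at (snd (chart_at A x) x)) v))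
    (at (snd (chart_at A x) x))"
    by (intro has_derivative_sum has_derivative_mult_right chart_has_derivative assms)
  show ?thesis
    by (subst field_derivI(2)[OF d]) (simp add: field_deriv_def Let_def)
qed

lemma
  assumes "chart_differentiable A f x" and "f x > 0" and "smooth_manifold A"
  shows field_deriv_ln: "field_deriv A K (\<lambda>y. ln (f y)) x = field_deriv A K f x / f x"
    and chart_differentiable_ln: "chart_differentiable A (\<lambda>y. ln (f y)) x"
proof -
  let ?D = "frechet_derivative (f \<circ> inv_chart (chart_at A x)) (at (snd (chart_at A x) x))"
  have d: "((\<lambda>a. ln (f (inv_chart (chart_at A x) a))) has_derivative
      (\<lambda>v. ?D v * inverse (f x))) (at (snd (chart_at A x) x))"
    using has_derivative_ln[OF _ chart_has_derivative[OF assms(1)]] assms(2)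
      chart_at_point(3)[OF assms(3), of x] by simp
  show "field_deriv A K (\<lambda>y. ln (f y)) x = field_deriv A K f x / f x"
    by (subst field_derivI(2)[OF d]) (simp add: field_deriv_def Let_def divide_inverse)
  show "chart_differentiable A (\<lambda>y. ln (f y)) x"
    by (rule field_derivI(1)[OF d])
qed

lemma
  fixes f :: "'h \<Rightarrow> real ^ 's"
  assumes "chart_differentiable A f x"
  shows field_deriv_inner:
      "field_deriv A K (\<lambda>y. v \<bullet> f y) x = v \<bullet> field_deriv_vec A K f x"
    and chart_differentiable_inner: "chart_differentiable A (\<lambda>y. v \<bullet> f y) x"
proof -
  note d = has_derivative_inner_right[OF chart_has_derivative[OF assms]]
  show "chart_differentiable A (\<lambda>y. v \<bullet> f y) x" for v
    by (rule field_derivI(1)[OF d])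
  \<comment> \<open>Inner products with unit vectors are the components that define
    \<open>field_deriv_vec\<close>.\<close>
  from this[of "axis i 1" for i] have "chart_differentiable A (\<lambda>y. f y $ i) x" for i
    by (simp add: inner_axis')
  then show "field_deriv A K (\<lambda>y. v \<bullet> f y) x = v \<bullet> field_deriv_vec A K f x"
    by (simp add: inner_vec_def field_deriv_vec_def field_deriv_sum_mult)
qed

section \<open>Quadratic forms of kernels\<close>

text \<open>This is the Gram form of the points \<open>x i\<close> enlarged by \<open>y\<close> with
  coefficient \<open>t\<close>, sorted by powers of \<open>t\<close>.\<close>

lemma psd_kernel_extend:
  fixes c :: "nat \<Rightarrow> real"
  assumes "psd_kernel \<kappa>"
  shows "0 \<le> t\<^sup>2 * \<kappa> y y + 2 * t * (\<Sum>j=1..n. c j * \<kappa> y (x j)) +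
    (\<Sum>i=1..n. \<Sum>j=1..n. c i * c j * \<kappa> (x i) (x j))"
proof -
  \<comment> \<open>Index 0 is free, as the given points are numbered from 1.\<close>
  define c' where "c' = c(0 := t)"
  define x' where "x' = x(0 := y)"
  have split: "(\<Sum>i<Suc n. F i) = F 0 + (\<Sum>i=1..n. F i)" for F :: "nat \<Rightarrow> real"
    by (simp only: sum.lessThan_Suc_shift image_Suc_lessThan[symmetric] sum.reindex inj_Suc o_def)
  have "0 \<le> (\<Sum>i<Suc n. \<Sum>j<Suc n. c' i * c' j * \<kappa> (x' i) (x' j))"
    using assms unfolding psd_kernel_def by blast
  also have "\<dots> = t * t * \<kappa> y y + (\<Sum>j=1..n. t * c j * \<kappa> y (x j)) +
      ((\<Sum>i=1..n. c i * t * \<kappa> (x i) y) + (\<Sum>i=1..n. \<Sum>j=1..n. c i * c j * \<kappa> (x i) (x j)))"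
    by (simp add: split c'_def x'_def sum.distrib del: sum.lessThan_Suc)
  also have "(\<Sum>i=1..n. c i * t * \<kappa> (x i) y) = (\<Sum>j=1..n. t * c j * \<kappa> y (x j))"
    using assms by (simp add: psd_kernel_def mult.commute)
  also have "(\<Sum>j=1..n. t * c j * \<kappa> y (x j)) = t * (\<Sum>j=1..n. c j * \<kappa> y (x j))"
    by (simp add: sum_distrib_left mult.assoc)
  finally show ?thesis
    by (simp add: power2_eq_square)
qed

lemma psd_kernel_nonneg:
  fixes c :: "nat \<Rightarrow> real"
  assumes "psd_kernel \<kappa>"
  shows "0 \<le> (\<Sum>i=1..n. \<Sum>j=1..n. c i * c j * \<kappa> (x i) (x j))"
  using psd_kernel_extend[OF assms, of 0] by simp

text \<open>The degenerate case of Cauchy-Schwarz: a combination of kernel sections of norm zero is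
  the zero function.\<close>

lemma psd_kernel_null_combination:
  fixes c :: "nat \<Rightarrow> real"
  assumes "psd_kernel \<kappa>" and "(\<Sum>i=1..n. \<Sum>j=1..n. c i * c j * \<kappa> (x i) (x j)) = 0"
  shows "(\<Sum>j=1..n. c j * \<kappa> y (x j)) = 0"
proof (rule linear_term_zero)
  show "0 \<le> t\<^sup>2 * \<kappa> y y + 2 * t * (\<Sum>j=1..n. c j * \<kappa> y (x j))" for t
    using psd_kernel_extend[OF assms(1), where t = t and y = y and n = n and c = c and x = x] unfolding assms(2) by simp
qed

section \<open>The Stein kernel of an exponential family\<close>

text \<open>Each summand of \<open>Q_fun\<close> is an outer product of two vectors, so its bilinear
  form factors.\<close>

lemma inner_Q_fun:
  fixes \<zeta> :: "'h \<Rightarrow> real ^ 's"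
  shows "u \<bullet> (Q_fun A m K \<kappa> \<zeta> y z *v v) =
     \<kappa> y z * (\<Sum>l=1..m. (u \<bullet> field_deriv_vec A (K l) \<zeta> y) * (v \<bullet> field_deriv_vec A (K l) \<zeta> z))"
proof -
  have outer: "u \<bullet> ((\<chi> i j. a $ i * b $ j) *v v) = (u \<bullet> a) * (v \<bullet> b)" for a b :: "real ^ 's"
  proof -
    have "(\<chi> i j. a $ i * b $ j) *v v = (v \<bullet> b) *\<^sub>R a"
      by (simp add: vec_eq_iff matrix_vector_mult_def inner_vec_def sum_distrib_left mult_ac)
    then show ?thesis
      by simp
  qed
  have sum: "(\<Sum>l\<in>I. M l) *v v = (\<Sum>l\<in>I. M l *v v)" for M :: "nat \<Rightarrow> real ^ 's ^ 's" and I
    by (induction I rule: infinite_finite_induct) (simp_all add: matrix_vector_mult_add_rdistrib)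
  show ?thesis
    by (simp add: Q_fun_def scaleR_matrix_vector_assoc[symmetric] sum inner_sum_right outer)
qed

lemma transpose_Q_fun:
  assumes "\<kappa> y z = \<kappa> z y"
  shows "transpose (Q_fun A m K \<kappa> \<zeta> y z) = Q_fun A m K \<kappa> \<zeta> z y"
  using assms by (simp add: Q_fun_def transpose_def vec_eq_iff mult.commute)

text \<open>The logarithm turns the product into a sum affine in \<open>\<theta>\<close>. The case
  \<open>\<theta> = 0\<close>, \<open>Z = 1\<close> covers the factor in
  \<open>b_fun\<close>.\<close>

lemma field_deriv_log_exponential_family:
  fixes \<zeta> :: "'h::{t2_space, second_countable_topology} \<Rightarrow> real ^ 's"
  assumes "smooth_manifold A" and "C1_fun A \<zeta>" and "C1_fun A \<eta>"
    and k: "chart_differentiable A k y" "\<And>y. k y > 0"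
    and "Z > 0" and p: "\<And>y. p y = exp (\<theta> \<bullet> \<zeta> y + \<eta> y) / Z"
  shows "field_deriv A K (\<lambda>x'. ln (p x' * k x')) y =
    \<theta> \<bullet> field_deriv_vec A K \<zeta> y + (field_deriv A K \<eta> y + field_deriv A K k y / k y)"
proof -
  note d = chart_differentiable_inner[OF C1_fun_chart_differentiable[OF assms(1,2)]]
    C1_fun_chart_differentiable[OF assms(1,3)] chart_differentiable_ln[OF k(1,2) assms(1)]
  have "ln (p x' * k x') = \<theta> \<bullet> \<zeta> x' + (\<eta> x' + ln (k x')) - ln Z" for x'
    using k(2)[of x'] \<open>Z > 0\<close> by (simp add: p ln_mult ln_div)
  then show ?thesis
    by (simp add: field_deriv_diff_const field_deriv_add chart_differentiable_add d
        field_deriv_inner C1_fun_chart_differentiable[OF assms(1,2)] field_deriv_ln k assms(1))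
qed

text \<open>Each log derivative is a part \<open>D\<close> linear in \<open>\<theta>\<close> plus a
  part \<open>\<beta>\<close> free of it. In their product \<open>D\<close> times \<open>D\<close>
  gives \<open>Q_fun\<close>, the mixed terms give \<open>b_fun\<close> in both argument orders, and
  the rest is the Stein kernel of \<open>exp \<eta>\<close>.\<close>

lemma stein_kernel_quadratic:
  fixes \<zeta> :: "'h::{t2_space, second_countable_topology} \<Rightarrow> real ^ 's"
  assumes A: "smooth_manifold A" and \<zeta>: "C1_fun A \<zeta>" and \<eta>: "C1_fun A \<eta>"
    and \<kappa>: "psd_kernel \<kappa>" "C11_kernel A \<kappa>" "\<forall>y z. \<kappa> y z > 0"
    and p: "\<exists>Z>0. \<forall>y. p y = exp (\<theta> \<bullet> \<zeta> y + \<eta> y) / Z"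
  shows "stein_kernel A m K \<kappa> p y z =
    \<theta> \<bullet> (Q_fun A m K \<kappa> \<zeta> y z *v \<theta>) + \<theta> \<bullet> b_fun A m K \<kappa> \<zeta> \<eta> y z +
    \<theta> \<bullet> b_fun A m K \<kappa> \<zeta> \<eta> z y + stein_kernel A m K \<kappa> (\<lambda>y. exp (\<eta> y)) y z"
proof -
  define D where "D l y = \<theta> \<bullet> field_deriv_vec A (K l) \<zeta> y" for l y
  define \<beta> where "\<beta> l y z = field_deriv A (K l) (\<lambda>x'. ln (exp (\<eta> x') * \<kappa> x' z)) y" for l y z
  obtain Z where Z: "Z > 0" "\<And>y. p y = exp (\<theta> \<bullet> \<zeta> y + \<eta> y) / Z"
    using p by blast
  have sym: "\<kappa> y z = \<kappa> z y" for y z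
    using \<kappa>(1) by (simp add: psd_kernel_def)
  note log_deriv = field_deriv_log_exponential_family[OF A \<zeta> \<eta>,
      where k = "\<lambda>x'. \<kappa> x' z" for z, OF C11_kernel_chart_differentiable[OF A \<kappa>(2)]]
  have \<beta>: "\<beta> l y z = field_deriv A (K l) \<eta> y + field_deriv A (K l) (\<lambda>x'. \<kappa> x' z) y / \<kappa> y z" for l y z
    unfolding \<beta>_def
    by (subst log_deriv[where Z = 1 and \<theta> = 0]) (use \<kappa>(3) in auto)
  have px: "field_deriv A (K l) (\<lambda>x'. ln (p x' * \<kappa> x' z)) y = D l y + \<beta> l y z" for l y z
    unfolding D_def \<beta> by (rule log_deriv) (use \<kappa>(3) Z in auto)
  \<comment> \<open>Symmetry of the kernel moves the second-argument derivative to the first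
    argument.\<close>
  have py: "field_deriv A (K l) (\<lambda>y'. ln (q y' * \<kappa> y y')) z =
      field_deriv A (K l) (\<lambda>y'. ln (q y' * \<kappa> y' y)) z" for l q y z
    by (simp add: sym[of y])
  have b: "\<theta> \<bullet> b_fun A m K \<kappa> \<zeta> \<eta> y z = \<kappa> y z * (\<Sum>l=1..m. \<beta> l y z * D l z)" for y z
    by (simp add: b_fun_def \<beta>_def D_def inner_sum_right)
  show ?thesis
    unfolding inner_Q_fun b stein_kernel_def py px D_def[symmetric] \<beta>_def[symmetric] sym[of z y]
    by (simp only: distrib_left[symmetric] sum.distrib[symmetric])
      (simp add: algebra_simps)
qed

section \<open>Weighted sums over pairs of points\<close>

text \<open>Treats both statistics at once: symmetric weights suffice for the symmetry of the
  matrices and for the quadratic expansion.\<close>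

definition pair_sum ::
  "(nat \<Rightarrow> nat \<Rightarrow> real) \<Rightarrow> nat \<Rightarrow> (nat \<Rightarrow> 'h) \<Rightarrow> ('h \<Rightarrow> 'h \<Rightarrow> 'b::real_vector) \<Rightarrow> 'b" where
  "pair_sum \<alpha> n x h = (\<Sum>i=1..n. \<Sum>j=1..n. \<alpha> i j *\<^sub>R h (x i) (x j))"

text \<open>A zero diagonal replaces the restriction to distinct indices, so all sums run over the
  full square.\<close>

definition U_weight :: "nat \<Rightarrow> (nat \<Rightarrow> 'h) \<Rightarrow> ('h \<Rightarrow> real) \<Rightarrow> nat \<Rightarrow> nat \<Rightarrow> real" where
  "U_weight n x w i j = (if i = j then 0 else w (x i) * w (x j) / (real n * (real n - 1)))"

definition V_weight :: "nat \<Rightarrow> (nat \<Rightarrow> 'h) \<Rightarrow> ('h \<Rightarrow> real) \<Rightarrow> nat \<Rightarrow> nat \<Rightarrow> real" where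
  "V_weight n x w i j = w (x i) * w (x j) / (real n)\<^sup>2"

lemma U_weight_sym: "U_weight n x w i j = U_weight n x w j i"
  by (simp add: U_weight_def)

lemma V_weight_sym: "V_weight n x w i j = V_weight n x w j i"
  by (simp add: V_weight_def)

lemma U_stat_eq_pair_sum: "U_stat n x w h = pair_sum (U_weight n x w) n x h"
proof -
  have "(\<Sum>j\<in>{1..n} - {i}. (w (x i) * w (x j) / (real n * (real n - 1))) *\<^sub>R h (x i) (x j)) =
      (\<Sum>j=1..n. U_weight n x w i j *\<^sub>R h (x i) (x j))" for i
    by (rule sum.mono_neutral_cong_left) (auto simp: U_weight_def)
  then show ?thesis
    by (simp add: U_stat_def pair_sum_def scaleR_sum_right)
qed

lemma V_stat_eq_pair_sum: "V_stat n x w h = pair_sum (V_weight n x w) n x h"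
  by (simp add: V_stat_def pair_sum_def scaleR_sum_right V_weight_def)

lemma pair_sum_linear: "linear L \<Longrightarrow> L (pair_sum \<alpha> n x h) = pair_sum \<alpha> n x (\<lambda>y z. L (h y z))"
  by (simp add: pair_sum_def linear_sum linear_scale)

lemma pair_sum_add:
  "pair_sum \<alpha> n x (\<lambda>y z. h y z + h' y z) = pair_sum \<alpha> n x h + pair_sum \<alpha> n x h'"
  by (simp add: pair_sum_def scaleR_add_right sum.distrib)

lemma pair_sum_flip:
  assumes "\<And>i j. \<alpha> i j = \<alpha> j i"
  shows "pair_sum \<alpha> n x (\<lambda>y z. h z y) = pair_sum \<alpha> n x h"
  unfolding pair_sum_def by (subst sum.swap) (simp add: assms)

lemma inner_pair_sum_matrix_vector:
  fixes h :: "'h \<Rightarrow> 'h \<Rightarrow> real ^ 'n ^ 'm"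
  shows
  "u \<bullet> (pair_sum \<alpha> n x h *v v) = pair_sum \<alpha> n x (\<lambda>y z. u \<bullet> (h y z *v v))"
  by (rule pair_sum_linear)
    (simp add: linear_iff matrix_vector_mult_add_rdistrib inner_add_right
      scaleR_matrix_vector_assoc[symmetric])

lemma inner_pair_sum: "u \<bullet> pair_sum \<alpha> n x h = pair_sum \<alpha> n x (\<lambda>y z. u \<bullet> h y z)"
  by (rule pair_sum_linear) (simp add: linear_iff inner_add_right)

text \<open>Transposition swaps the arguments of \<open>Q_fun\<close>, and symmetric weights undo
  the swap.\<close>

lemma symmetric_matrix_pair_sum_Q_fun:
  fixes \<zeta> :: "'h \<Rightarrow> real ^ 's"
  assumes "psd_kernel \<kappa>" and \<alpha>: "\<And>i j. \<alpha> i j = \<alpha> j i"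
  shows "symmetric_matrix (pair_sum \<alpha> n x (Q_fun A m K \<kappa> \<zeta>))"
proof -
  have "linear (transpose :: real ^ 's ^ 's \<Rightarrow> _)"
    by (simp add: linear_iff transpose_def vec_eq_iff)
  then have "transpose (pair_sum \<alpha> n x (Q_fun A m K \<kappa> \<zeta>)) =
      pair_sum \<alpha> n x (\<lambda>y z. transpose (Q_fun A m K \<kappa> \<zeta> y z))"
    by (rule pair_sum_linear)
  also have "\<dots> = pair_sum \<alpha> n x (\<lambda>y z. Q_fun A m K \<kappa> \<zeta> z y)"
    using assms(1) by (simp add: transpose_Q_fun psd_kernel_def)
  also have "\<dots> = pair_sum \<alpha> n x (Q_fun A m K \<kappa> \<zeta>)"
    by (rule pair_sum_flip[OF \<alpha>])
  finally show ?thesis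
    unfolding symmetric_matrix_def .
qed

text \<open>Under symmetric weights the two \<open>b_fun\<close> terms have equal sums, whence the
  factor 2.\<close>

lemma pair_sum_stein_kernel:
  fixes \<zeta> :: "'h::{t2_space, second_countable_topology} \<Rightarrow> real ^ 's"
  assumes "smooth_manifold A" "C1_fun A \<zeta>" "C1_fun A \<eta>"
    and "psd_kernel \<kappa>" "C11_kernel A \<kappa>" "\<forall>y z. \<kappa> y z > 0"
    and "\<exists>Z>0. \<forall>y. p y = exp (\<theta> \<bullet> \<zeta> y + \<eta> y) / Z"
    and \<alpha>: "\<And>i j. \<alpha> i j = \<alpha> j i"
  shows "pair_sum \<alpha> n x (stein_kernel A m K \<kappa> p) =
    \<theta> \<bullet> (pair_sum \<alpha> n x (Q_fun A m K \<kappa> \<zeta>) *v \<theta>) +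
    2 * (pair_sum \<alpha> n x (b_fun A m K \<kappa> \<zeta> \<eta>) \<bullet> \<theta>) +
    pair_sum \<alpha> n x (stein_kernel A m K \<kappa> (\<lambda>y. exp (\<eta> y)))"
proof -
  let ?b = "\<lambda>y z. \<theta> \<bullet> b_fun A m K \<kappa> \<zeta> \<eta> y z"
  have "stein_kernel A m K \<kappa> p = (\<lambda>y z. \<theta> \<bullet> (Q_fun A m K \<kappa> \<zeta> y z *v \<theta>) + ?b y z + ?b z y +
      stein_kernel A m K \<kappa> (\<lambda>y. exp (\<eta> y)) y z)"
    by (intro ext stein_kernel_quadratic assms)
  then show ?thesis
    using pair_sum_flip[where \<alpha> = \<alpha> and h = ?b, OF \<alpha>]
    by (simp add: pair_sum_add inner_pair_sum_matrix_vector
        inner_pair_sum inner_commute[of _ \<theta>])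
qed

section \<open>Positivity and the range condition for the V-statistic\<close>

text \<open>With the diagonal present the weights factor, so each \<open>l\<close> contributes a
  Gram form of the kernel with coefficients \<open>c l v\<close>.\<close>

lemma V_stat_Q_fun_form:
  fixes n :: nat and x :: "nat \<Rightarrow> 'h" and \<zeta> :: "'h \<Rightarrow> real ^ 's" and qw :: "'h \<Rightarrow> real"
    and A :: "('h, 'e::euclidean_space) chart set" and K :: "nat \<Rightarrow> 'h \<Rightarrow> ('h, 'e) tangent"
  defines "c l v i \<equiv> qw (x i) * (v \<bullet> field_deriv_vec A (K l) \<zeta> (x i))"
  shows "v \<bullet> (V_stat n x qw (Q_fun A m K \<kappa> \<zeta>) *v v) =
    (\<Sum>l=1..m. \<Sum>i=1..n. \<Sum>j=1..n. c l v i * c l v j * \<kappa> (x i) (x j)) / (real n)\<^sup>2"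
proof -
  have "v \<bullet> (V_stat n x qw (Q_fun A m K \<kappa> \<zeta>) *v v) =
      (\<Sum>i=1..n. \<Sum>j=1..n. \<Sum>l=1..m. c l v i * c l v j * \<kappa> (x i) (x j) / (real n)\<^sup>2)"
    unfolding V_stat_eq_pair_sum inner_pair_sum_matrix_vector inner_Q_fun
    by (simp add: pair_sum_def V_weight_def c_def sum_distrib_left sum_divide_distrib mult_ac)
  also have "\<dots> = (\<Sum>l=1..m. \<Sum>i=1..n. \<Sum>j=1..n. c l v i * c l v j * \<kappa> (x i) (x j) / (real n)\<^sup>2)"
    by (subst sum.swap[where A = "{1..m}"]) (intro sum.cong refl sum.swap)
  finally show ?thesis
    by (simp add: sum_divide_distrib)
qed

lemma psd_matrix_V_stat_Q_fun:
  assumes "psd_kernel \<kappa>"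
  shows "psd_matrix (V_stat n x qw (Q_fun A m K \<kappa> \<zeta>))"
  unfolding psd_matrix_def
proof (intro conjI allI)
  show "symmetric_matrix (V_stat n x qw (Q_fun A m K \<kappa> \<zeta>))"
    unfolding V_stat_eq_pair_sum
    by (rule symmetric_matrix_pair_sum_Q_fun[OF assms V_weight_sym])
  show "0 \<le> v \<bullet> (V_stat n x qw (Q_fun A m K \<kappa> \<zeta>) *v v)" for v
    unfolding V_stat_Q_fun_form
    by (intro divide_nonneg_nonneg sum_nonneg[OF psd_kernel_nonneg[OF assms]]) simp
qed

text \<open>A vector \<open>v\<close> in the kernel of \<open>Q\<^sub>v\<close> makes the linear combinations of kernel sections
  \<open>\<Sum>\<^sub>j c\<^sub>j \<kappa>(\<cdot>, x\<^sub>j)\<close> with \<open>c\<^sub>j = q\<^sup>w(x\<^sub>j) K\<^sup>l(v \<bullet> \<zeta>)(x\<^sub>j)\<close> vanish identically, so their derivatives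
  vanish too; these are the quantities that \<open>b\<^sub>v \<bullet> v\<close> is made of.\<close>

lemma V_stat_b_fun_orthogonal:
  fixes \<zeta> :: "'h::{t2_space, second_countable_topology} \<Rightarrow> real ^ 's"
  assumes A: "smooth_manifold A" and \<zeta>: "C1_fun A \<zeta>" and \<eta>: "C1_fun A \<eta>"
    and \<kappa>: "psd_kernel \<kappa>" "C11_kernel A \<kappa>" "\<forall>y z. \<kappa> y z > 0"
    and n: "n > 0" and v: "V_stat n x qw (Q_fun A m K \<kappa> \<zeta>) *v v = 0"
  shows "V_stat n x qw (b_fun A m K \<kappa> \<zeta> \<eta>) \<bullet> v = 0"
proof -
  define c where "c l i = qw (x i) * (v \<bullet> field_deriv_vec A (K l) \<zeta> (x i))" for l i
  let ?S = "\<lambda>l. \<Sum>i=1..n. \<Sum>j=1..n. c l i * c l j * \<kappa> (x i) (x j)"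
  have "(\<Sum>l=1..m. ?S l) = 0"
    using V_stat_Q_fun_form[of v n x qw A m K \<kappa> \<zeta>] v n by (simp add: c_def)
  \<comment> \<open>Nonnegative Gram forms with sum zero vanish one by one.\<close>
  then have "?S l = 0" if "l \<in> {1..m}" for l
    using that psd_kernel_nonneg[OF \<kappa>(1)] by (subst (asm) sum_nonneg_eq_0_iff) auto
  then have null: "(\<Sum>j=1..n. c l j * \<kappa> y (x j)) = 0" if "l \<in> {1..m}" for l y
    using that psd_kernel_null_combination[OF \<kappa>(1)] by blast
  note diff = C11_kernel_chart_differentiable[OF A \<kappa>(2)]
  have dnull: "(\<Sum>j=1..n. c l j * field_deriv A (K l) (\<lambda>x'. \<kappa> x' (x j)) y) = 0"
    if "l \<in> {1..m}" for l y
  proof -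
    have "(\<Sum>j=1..n. c l j * field_deriv A (K l) (\<lambda>x'. \<kappa> x' (x j)) y) =
        field_deriv A (K l) (\<lambda>x'. \<Sum>j=1..n. c l j * \<kappa> x' (x j)) y"
      by (rule field_deriv_sum_mult[symmetric]) (rule diff)
    then show ?thesis
      by (simp add: null[OF that] field_deriv_const del: One_nat_def)
  qed
  \<comment> \<open>Multiplication by the kernel clears the denominator of its log derivative,
    leaving terms linear in the kernel.\<close>
  have \<beta>: "\<kappa> y z * field_deriv A (K l) (\<lambda>x'. ln (exp (\<eta> x') * \<kappa> x' z)) y =
      field_deriv A (K l) \<eta> y * \<kappa> y z + field_deriv A (K l) (\<lambda>x'. \<kappa> x' z) y" for l y z
    using \<kappa>(3) field_deriv_log_exponential_family[OF A \<zeta> \<eta> diff, of z 1 _ 0]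
    by (simp add: field_simps less_imp_neq[symmetric])
  have "v \<bullet> V_stat n x qw (b_fun A m K \<kappa> \<zeta> \<eta>) =
      (\<Sum>i=1..n. \<Sum>j=1..n. \<Sum>l=1..m. qw (x i) / (real n)\<^sup>2 * (c l j *
        (\<kappa> (x i) (x j) * field_deriv A (K l) (\<lambda>x'. ln (exp (\<eta> x') * \<kappa> x' (x j))) (x i))))"
    by (simp add: V_stat_eq_pair_sum inner_pair_sum pair_sum_def b_fun_def inner_sum_right
        V_weight_def c_def sum_distrib_left mult_ac)
  \<comment> \<open>With \<open>j\<close> innermost, both inner sums are of the kind covered by
    \<open>null\<close> and \<open>dnull\<close>.\<close>
  also have "\<dots> = (\<Sum>i=1..n. \<Sum>l=1..m. qw (x i) / (real n)\<^sup>2 *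
      (field_deriv A (K l) \<eta> (x i) * (\<Sum>j=1..n. c l j * \<kappa> (x i) (x j)) +
       (\<Sum>j=1..n. c l j * field_deriv A (K l) (\<lambda>x'. \<kappa> x' (x j)) (x i))))"
    unfolding \<beta>
    by (subst sum.swap[where A = "{1..n}" and B = "{1..m}"])
      (simp add: sum_distrib_left distrib_left sum.distrib mult_ac)
  also have "\<dots> = 0"
    by (simp add: null dnull del: One_nat_def)
  finally show ?thesis
    by (simp add: inner_commute)
qed

text \<open>Without the diagonal terms \<open>bu\<close> may leave the range of \<open>Qu\<close>,
  even for \<open>Qu = 0\<close>; then \<open>U\<close> is unbounded below and has no minimizer. So
  the formula for \<open>U\<close> is stated for an attained minimum, whereas for \<open>V\<close>
  attainment is proved.\<close>

theorem theorem5p1: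
  fixes AH :: "('h::{t2_space, second_countable_topology}, 'e::euclidean_space) chart set"
    and g :: "'h \<Rightarrow> ('h, 'e) tangent \<Rightarrow> ('h, 'e) tangent \<Rightarrow> real"
    and G :: "('g::{t2_space, second_countable_topology}) monoid"
    and AG :: "('g, 'd::euclidean_space) chart set"
    and act :: "'g \<Rightarrow> 'h \<Rightarrow> 'h"
    and m :: nat
    and E :: "nat \<Rightarrow> ('g, 'd) tangent"
    and K :: "nat \<Rightarrow> 'h \<Rightarrow> ('h, 'e) tangent"
    and \<kappa> :: "'h \<Rightarrow> 'h \<Rightarrow> real"
    and \<zeta> :: "'h \<Rightarrow> real ^ 's"
    and \<eta> :: "'h \<Rightarrow> real"
    and p :: "real ^ 's \<Rightarrow> 'h \<Rightarrow> real"
    and n :: nat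
    and x :: "nat \<Rightarrow> 'h"
    and qw :: "'h \<Rightarrow> real"
    and U V :: "real ^ 's \<Rightarrow> real"
    and Qu Qv :: "real ^ 's ^ 's"
    and bu bv :: "real ^ 's"
  assumes "riemannian_homogeneous_space AH g G AG act"
    and "tangent_basis AG \<one>\<^bsub>G\<^esub> m E"
    and "\<forall>l\<in>{1..m}. killing_field AH G AG act (E l) (K l)"
    and "psd_kernel \<kappa>" and "C11_kernel AH \<kappa>" and "\<forall>y z. \<kappa> y z > 0"
    and "C1_fun AH \<zeta>" and "C1_fun AH \<eta>"
    and "\<forall>\<theta>. \<exists>Z>0. \<forall>y. p \<theta> y = exp (\<theta> \<bullet> \<zeta> y + \<eta> y) / Z"
    and "n \<ge> 2"
    and "\<forall>y. qw y \<ge> 0"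
    and "U = (\<lambda>\<theta>. U_stat n x qw (stein_kernel AH m K \<kappa> (p \<theta>)))"
    and "V = (\<lambda>\<theta>. V_stat n x qw (stein_kernel AH m K \<kappa> (p \<theta>)))"
    and "Qu = U_stat n x qw (Q_fun AH m K \<kappa> \<zeta>)"
    and "Qv = V_stat n x qw (Q_fun AH m K \<kappa> \<zeta>)"
    and "bu = U_stat n x qw (b_fun AH m K \<kappa> \<zeta> \<eta>)"
    and "bv = V_stat n x qw (b_fun AH m K \<kappa> \<zeta> \<eta>)"
  shows "symmetric_matrix Qu \<and> symmetric_matrix Qv \<and> psd_matrix Qv \<and>
    (psd_matrix Qu \<longrightarrow>
      (argmin U \<noteq> {} \<longrightarrow>
        argmin U = {- (pinv Qu *v bu) - (mat 1 - pinv Qu ** Qu) *v z | z. z \<in> UNIV}) \<and>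
      argmin V = {- (pinv Qv *v bv) - (mat 1 - pinv Qv ** Qv) *v z | z. z \<in> UNIV})"
proof -
  have A: "smooth_manifold AH"
    using assms(1) by (simp add: riemannian_homogeneous_space_def)
  note Qu = assms(14) and Qv = assms(15) and bu = assms(16) and bv = assms(17)
  note quadratic = pair_sum_stein_kernel[OF A assms(7,8,4-6) assms(9)[rule_format]]
  have U: "U \<theta> = \<theta> \<bullet> (Qu *v \<theta>) + 2 * (bu \<bullet> \<theta>) +
      U_stat n x qw (stein_kernel AH m K \<kappa> (\<lambda>y. exp (\<eta> y)))" for \<theta>
    unfolding assms(12) Qu bu U_stat_eq_pair_sum by (rule quadratic[OF U_weight_sym])
  have V: "V \<theta> = \<theta> \<bullet> (Qv *v \<theta>) + 2 * (bv \<bullet> \<theta>) +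
      V_stat n x qw (stein_kernel AH m K \<kappa> (\<lambda>y. exp (\<eta> y)))" for \<theta>
    unfolding assms(13) Qv bv V_stat_eq_pair_sum by (rule quadratic[OF V_weight_sym])
  have symQu: "symmetric_matrix Qu"
    unfolding Qu U_stat_eq_pair_sum
    by (rule symmetric_matrix_pair_sum_Q_fun[OF assms(4) U_weight_sym])
  have psdQv: "psd_matrix Qv"
    unfolding Qv by (rule psd_matrix_V_stat_Q_fun[OF assms(4)])
  then have symQv: "symmetric_matrix Qv"
    by (simp add: psd_matrix_def)
  have "bv \<bullet> v = 0" if "Qv *v v = 0" for v
    using V_stat_b_fun_orthogonal[OF A assms(7,8,4-6)] that assms(10) unfolding Qv bv by simp
  then have "\<exists>\<theta>. Qv *v \<theta> = - bv"
    by (intro symmetric_solvable symQv) simp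
  then have argminV: "argmin V = {- (pinv Qv *v bv) - (mat 1 - pinv Qv ** Qv) *v z | z. z \<in> UNIV}"
    using argmin_quadratic_pinv[OF psdQv V] by auto
  show ?thesis
    by (intro conjI impI symQu symQv psdQv argminV argmin_quadratic_pinv[OF _ U] disjI2)
qed

end
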